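(* Let $f_1,f_2:[0,1]\times[0,+\infty)^2\rightarrow[0,+\infty)$ be continuous functions such that for each $i\in\{1,2\}$ (with $j\neq i$ the other index) and each $M_i>0$ there exists $C_i>0$ with $$f_i(t,x_1,x_2)\leq C_i\quad\text{for all } x_i\in[0,M_i],\ x_j\in[0,+\infty),\ t\in[0,1].$$ Let $\mu_1$ be the smallest positive characteristic value of the linear operator $L$ (that is, $\mu_1=1/\lambda_1$ with $\lambda_1$ the largest real eigenvalue of $L$; $\mu_1=\pi^2/4$), where $L$ is the integral operator defined in the context. Assume that for each $i\in\{1,2\}$ the limits $$(f_i)_{0}:=\lim_{x_i\to 0^+}\frac{f_i(t,x_1,x_2)}{x_i},\qquad (f_i)_{\infty}:=\lim_{x_i\to+\infty}\frac{f_i(t,x_1,x_2)}{x_i}$$ satisfy $$\mu_1<(f_i)_{0}\leq+\infty\quad\text{and}\quad 0\leq(f_i)_{\infty}<\mu_1,\quad\text{uniformly for } t\in[0,1],\ x_j\in[0,+\infty)\ (j\neq i).$$ Then the system $$\begin{cases} x''(t)+f_1(t,x(t),y(t))=0, & t\in[0,1],\\ y''(t)+f_2(t,x(t),y(t))=0, & t\in[0,1],\\ x'(0)=x(1)=0=y'(0)=y(1)\end{cases}$$ has at least one positive solution $(x,y)$ which is non-trivial in both components.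
   Context: The operator $L$ on $\mathcal{C}([0,1])$ is $$Lu(t)=\int_0^1 G(t,s)u(s)\,ds,\quad t\in[0,1],\qquad G(t,s)=\begin{cases}1-t & \text{if } 0\leq s\leq t\leq 1,\\ 1-s & \text{if } 0\leq t<s\leq 1,\end{cases}$$ and an eigenvalue of $L$ is a number $\lambda$ such that $\lambda u=Lu$ for some $u\not\equiv 0$. The limits $(f_i)_0$ and $(f_i)_\infty$ are values in $[0,+\infty]$, and "uniformly for $t$, $x_j$" means that the limits hold uniformly with respect to $t\in[0,1]$ and $x_j\in[0,+\infty)$ (if $(f_i)_0=+\infty$: for every $A>0$ there is $\delta>0$ such that $f_i(t,x_1,x_2)\geq A x_i$ for all $x_i\in(0,\delta]$, $t\in[0,1]$, $x_j\in[0,+\infty)$). A positive solution, non-trivial in both components, is a pair of functions $x,y\in\mathcal{C}^2([0,1])$ solving the system with $x(t)\geq 0$, $y(t)\geq 0$ for all $t\in[0,1]$, $x\not\equiv 0$ and $y\not\equiv 0$. *)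

theory Defs
  imports "HOL-Analysis.Analysis"
begin

definition G :: "real \<Rightarrow> real \<Rightarrow> real" where
  "G t s = (if s \<le> t then 1 - t else 1 - s)"

text \<open>Elements of $C([0,1])$ are represented by functions \<^typ>\<open>real \<Rightarrow> real\<close> that are
  continuous on \<^term>\<open>{0..1::real}\<close>; their values outside of the interval are irrelevant.\<close>

definition L :: "(real \<Rightarrow> real) \<Rightarrow> real \<Rightarrow> real" where
  "L u t = integral {0..1} (\<lambda>s. G t s * u s)"

definition L_eigenvalue :: "real \<Rightarrow> bool" where
  "L_eigenvalue c \<longleftrightarrow>
     (\<exists>u. continuous_on {0..1} u \<and> (\<exists>t\<in>{0..1}. u t \<noteq> 0) \<and> (\<forall>t\<in>{0..1}. c * u t = L u t))"

definition L_characteristic_value :: "real \<Rightarrow> bool" where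
  "L_characteristic_value \<mu> \<longleftrightarrow> \<mu> \<noteq> 0 \<and> L_eigenvalue (1 / \<mu>)"

definition \<mu>\<^sub>1 :: real where
  "\<mu>\<^sub>1 = (LEAST \<mu>. 0 < \<mu> \<and> L_characteristic_value \<mu>)"

text \<open>Uniform convergence on \<open>S\<close>, along the filter \<open>F\<close>, to a constant that may be infinite.
  The type \<^typ>\<open>ereal\<close> carries no metric, so \<^const>\<open>uniform_limit\<close> covers only the finite case.\<close>

definition uniform_ereal_limit ::
    "'p set \<Rightarrow> ('a \<Rightarrow> 'p \<Rightarrow> real) \<Rightarrow> ereal \<Rightarrow> 'a filter \<Rightarrow> bool" where
  "uniform_ereal_limit S q l F \<longleftrightarrow>
     (case l of
        ereal r \<Rightarrow> uniform_limit S q (\<lambda>_. r) F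
      | PInfty \<Rightarrow> (\<forall>A>0. \<forall>\<^sub>F x in F. \<forall>p\<in>S. A \<le> q x p)
      | MInfty \<Rightarrow> (\<forall>A>0. \<forall>\<^sub>F x in F. \<forall>p\<in>S. q x p \<le> - A))"

text \<open>\<open>u\<close> belongs to $C^2([0,1])$, with first and second derivatives \<open>u'\<close> and \<open>u''\<close> on the interval
  (one-sided at the endpoints).\<close>

definition C2_with_derivs :: "(real \<Rightarrow> real) \<Rightarrow> (real \<Rightarrow> real) \<Rightarrow> (real \<Rightarrow> real) \<Rightarrow> bool" where
  "C2_with_derivs u u' u'' \<longleftrightarrow>
     (\<forall>t\<in>{0..1}. (u has_real_derivative u' t) (at t within {0..1})) \<and>
     (\<forall>t\<in>{0..1}. (u' has_real_derivative u'' t) (at t within {0..1})) \<and>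
     continuous_on {0..1} u''"

definition solves_system ::
    "(real \<Rightarrow> real \<Rightarrow> real \<Rightarrow> real) \<Rightarrow> (real \<Rightarrow> real \<Rightarrow> real \<Rightarrow> real) \<Rightarrow>
     (real \<Rightarrow> real) \<Rightarrow> (real \<Rightarrow> real) \<Rightarrow> bool" where
  "solves_system f1 f2 x y \<longleftrightarrow>
     (\<exists>x' x'' y' y''. C2_with_derivs x x' x'' \<and> C2_with_derivs y y' y'' \<and>
        (\<forall>t\<in>{0..1}. x'' t + f1 t (x t) (y t) = 0) \<and>
        (\<forall>t\<in>{0..1}. y'' t + f2 t (x t) (y t) = 0) \<and>
        x' 0 = 0 \<and> x 1 = 0 \<and> y' 0 = 0 \<and> y 1 = 0)"

end

theory Submission
  imports Defs "HOL-Complex_Analysis.Great_Picard"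
begin

text \<open>A solution is found by shooting from \<open>t = 0\<close>. Starting with \<open>x 0 = \<alpha>\<close>, \<open>y 0 = \<beta>\<close> and
  zero slopes, one asks for \<open>(\<alpha>, \<beta>)\<close> such that both components vanish at \<open>t = 1\<close>. Since \<open>f\<^sub>i\<close> is
  nonnegative, both components decrease, and each of them is controlled by its own initial value,
  whatever the other one does. If \<open>\<alpha>\<close> is small, then \<open>- x'' \<ge> b x\<close> with \<open>b > \<mu>\<^sub>1\<close>, and \<open>x\<close> has dropped
  to zero by the time \<open>cos (sqrt b t)\<close> vanishes, which is before \<open>t = 1\<close>. If \<open>\<alpha>\<close> is large, then
  \<open>- x'' \<le> a x + C\<close> with \<open>a < \<mu>\<^sub>1\<close>, and \<open>x\<close> stays above a positive multiple of \<open>cos (sqrt a t)\<close>, which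
  has no zero in the interval. Hence on a rectangle of initial values the final values have the signs
  required by the Poincare--Miranda theorem, which is Brouwer's theorem in the plane. As \<open>\<alpha>\<close> and \<open>\<beta>\<close>
  are bounded away from zero, the solution obtained is non-trivial in both components.

  The functions \<open>f\<^sub>i\<close> are only continuous, so the initial value problem need not be uniquely solvable
  and the final values need not be functions of \<open>(\<alpha>, \<beta>)\<close>. Following Tonelli, the right-hand side is
  therefore evaluated at the past state \<open>(x, y) (max 0 (s - h))\<close>. The delayed problem is solved
  explicitly in finitely many steps, its solution is continuous in \<open>(\<alpha>, \<beta>)\<close>
  (\<open>delayed_solution_exists\<close>), and both sign estimates survive when \<open>h\<close> is small
  (\<open>shot_from_low_height\<close>, \<open>shot_from_large_height\<close>). The delayed boundary value problems are solved
  in \<open>delayed_bvp_solution\<close>, and letting \<open>h\<close> tend to zero with the Arzela--Ascoli theorem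
  (\<open>delayed_solutions_limit\<close>) gives the solution of the system.

  All comparisons rest on one computation: for \<open>W = x' cos (\<omega> t) + \<omega> x sin (\<omega> t)\<close>, the Wronskian of
  \<open>x\<close> with \<open>cos (\<omega> t)\<close>, one has \<open>W' = cos (\<omega> t) (x'' + \<omega>\<^sup>2 x)\<close>. The same computation shows that
  \<open>\<mu>\<^sub>1 = pi\<^sup>2 / 4\<close>.\<close>

section \<open>Twofold integration and Sturm comparison\<close>

text \<open>The solution of \<open>x'' = F\<close> with \<open>x 0 = 0 = x' 0\<close>. Writing the kernel as
  \<open>max 0 (t - s)\<close> keeps the domain of integration independent of \<open>t\<close>, so that theorems on integrals
  with a parameter apply directly; it is also total in \<open>t\<close>, with value zero for \<open>t \<le> 0\<close>.\<close>

definition volterra :: "(real \<Rightarrow> 'a::euclidean_space) \<Rightarrow> real \<Rightarrow> 'a" where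
  "volterra F t = integral {0..1} (\<lambda>s. max 0 (t - s) *\<^sub>R F s)"

lemma volterra_0: "t \<le> 0 \<Longrightarrow> volterra F t = 0"
proof -
  assume t: "t \<le> 0"
  have "volterra F t = integral {0..1} (\<lambda>s::real. 0)"
    unfolding volterra_def using t by (intro integral_cong) (auto simp: max_def)
  then show ?thesis by simp
qed

text \<open>Causality: the value at \<open>t\<close> depends on the past only. This makes the delayed equation
  solvable step by step.\<close>

lemma volterra_cong:
  "(\<And>s. s \<in> {0..1} \<Longrightarrow> s < t \<Longrightarrow> F s = H s) \<Longrightarrow> volterra F t = volterra H t"
  unfolding volterra_def by (intro integral_cong) (auto simp: max_def)

lemma volterra_linear:
  assumes "bounded_linear T" "continuous_on {0..1} F"
  shows "T (volterra F t) = volterra (\<lambda>s. T (F s)) t"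
proof -
  interpret bounded_linear T by fact
  have "(\<lambda>s. max 0 (t - s) *\<^sub>R F s) integrable_on {0..1}"
    by (intro integrable_continuous_real continuous_intros assms)
  from integral_linear[OF this assms(1)] show ?thesis
    by (simp add: volterra_def o_def scaleR)
qed

lemma volterra_Lipschitz:
  assumes F: "continuous_on {0..1} F" and K: "\<And>s. s \<in> {0..1} \<Longrightarrow> norm (F s) \<le> K"
  shows "norm (volterra F t - volterra F r) \<le> K * \<bar>t - r\<bar>"
proof -
  let ?g = "\<lambda>s. (max 0 (t - s) - max 0 (r - s)) *\<^sub>R F s"
  have "volterra F t - volterra F r = integral {0..1} ?g"
    unfolding volterra_def scaleR_left_diff_distrib
    by (intro integral_diff[symmetric] integrable_continuous_real continuous_intros F)
  also have "norm \<dots> \<le> integral {0..1} (\<lambda>s::real. K * \<bar>t - r\<bar>)"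
  proof (rule integral_norm_bound_integral)
    show "?g integrable_on {0..1}"
      by (intro integrable_continuous_real continuous_intros F)
    fix s :: real assume s: "s \<in> {0..1}"
    have "norm (?g s) = \<bar>max 0 (t - s) - max 0 (r - s)\<bar> * norm (F s)" by simp
    also have "\<dots> \<le> \<bar>t - r\<bar> * K" using K[OF s] by (intro mult_mono) auto
    finally show "norm (?g s) \<le> K * \<bar>t - r\<bar>" by (simp add: mult.commute)
  qed auto
  finally show ?thesis by simp
qed

lemma volterra_mono:
  fixes F :: "real \<Rightarrow> real"
  assumes F: "continuous_on {0..1} F" "\<And>s. s \<in> {0..1} \<Longrightarrow> 0 \<le> F s" and "r \<le> t"
  shows "volterra F r \<le> volterra F t"
  unfolding volterra_def using assms
  by (intro integral_le integrable_continuous_real continuous_intros) (auto intro!: mult_right_mono)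

text \<open>In this form the fundamental theorem of calculus can be applied twice.\<close>

lemma volterra_eq_integrals:
  fixes F :: "real \<Rightarrow> real"
  assumes F: "continuous_on {0..1} F" and t: "t \<in> {0..1}"
  shows "volterra F t = t * integral {0..t} F - integral {0..t} (\<lambda>s. s * F s)"
proof -
  have Ft: "continuous_on {0..t} F"
    using F t by (auto intro: continuous_on_subset)
  have "volterra F t = integral {0..t} (\<lambda>s. max 0 (t - s) *\<^sub>R F s)
      + integral {t..1} (\<lambda>s. max 0 (t - s) *\<^sub>R F s)"
    unfolding volterra_def using t
    by (intro Henstock_Kurzweil_Integration.integral_combine[symmetric] integrable_continuous_real
        continuous_intros F) auto
  also have "integral {t..1} (\<lambda>s. max 0 (t - s) *\<^sub>R F s) = integral {t..1} (\<lambda>s. 0)"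
    by (intro integral_cong) auto
  also have "integral {0..t} (\<lambda>s. max 0 (t - s) *\<^sub>R F s) = integral {0..t} (\<lambda>s. t * F s - s * F s)"
    by (intro integral_cong) (auto simp: algebra_simps)
  also have "\<dots> = t * integral {0..t} F - integral {0..t} (\<lambda>s. s * F s)"
    by (subst integral_diff) (auto intro!: integrable_continuous_real continuous_intros Ft)
  finally show ?thesis by simp
qed

lemma volterra_C2:
  assumes F: "continuous_on {0..1} F" and x: "\<And>t. t \<in> {0..1} \<Longrightarrow> x t = c - volterra F t"
  shows "C2_with_derivs x (\<lambda>t. - integral {0..t} F) (\<lambda>t. - F t)"
  unfolding C2_with_derivs_def
proof (intro conjI ballI)
  fix t :: real assume t: "t \<in> {0..1}"
  have "((\<lambda>t. c - (t * integral {0..t} F - integral {0..t} (\<lambda>s. s * F s)))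
      has_real_derivative - integral {0..t} F) (at t within {0..1})"
    using t F by (auto intro!: derivative_eq_intros integral_has_real_derivative continuous_intros)
  then show "(x has_real_derivative - integral {0..t} F) (at t within {0..1})"
    by (rule has_field_derivative_transform_within[OF _ zero_less_one t])
       (use x volterra_eq_integrals[OF F] in auto)
  show "((\<lambda>t. - integral {0..t} F) has_real_derivative - F t) (at t within {0..1})"
    using t F by (auto intro!: derivative_eq_intros integral_has_real_derivative)
qed (intro continuous_intros F)

lemma C2_diff:
  assumes "C2_with_derivs x x' x''" "C2_with_derivs y y' y''"
  shows "C2_with_derivs (\<lambda>t. x t - y t) (\<lambda>t. x' t - y' t) (\<lambda>t. x'' t - y'' t)"
  using assms unfolding C2_with_derivs_def by (auto intro!: derivative_eq_intros continuous_intros)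

lemma C2_minus:
  assumes "C2_with_derivs x x' x''"
  shows "C2_with_derivs (\<lambda>t. - x t) (\<lambda>t. - x' t) (\<lambda>t. - x'' t)"
  using assms unfolding C2_with_derivs_def by (auto intro!: derivative_eq_intros continuous_intros)

lemma nondecreasing_on_Icc:
  fixes f :: "real \<Rightarrow> real"
  assumes "\<And>t. t \<in> {a..b} \<Longrightarrow> (f has_real_derivative f' t) (at t within {a..b})"
    and "\<And>t. t \<in> {a..b} \<Longrightarrow> 0 \<le> f' t" and "a \<le> b"
  shows "f a \<le> f b"
proof (rule DERIV_nonneg_imp_increasing_open[OF \<open>a \<le> b\<close>])
  show "continuous_on {a..b} f"
    using assms(1) by (rule DERIV_continuous_on)
  show "\<exists>y. DERIV f t :> y \<and> 0 \<le> y" if "a < t" "t < b" for t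
    using assms(1)[of t] assms(2)[of t] that by (auto simp: at_within_Icc_at)
qed

lemma wronskian_cos_derivative:
  assumes "C2_with_derivs x x' x''" "t \<in> {0..1}"
  shows "((\<lambda>t. x' t * cos (\<omega> * t) + \<omega> * x t * sin (\<omega> * t)) has_real_derivative
     cos (\<omega> * t) * (x'' t + \<omega>\<^sup>2 * x t)) (at t within {0..1})"
  using assms unfolding C2_with_derivs_def
  by (auto intro!: derivative_eq_intros simp: algebra_simps power2_eq_square)

lemma quotient_cos_derivative:
  assumes "C2_with_derivs x x' x''" "t \<in> {0..1}" "cos (\<omega> * t) \<noteq> 0"
  shows "((\<lambda>t. x t / cos (\<omega> * t)) has_real_derivative
     (x' t * cos (\<omega> * t) + \<omega> * x t * sin (\<omega> * t)) / (cos (\<omega> * t))\<^sup>2) (at t within {0..1})"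
  using assms unfolding C2_with_derivs_def
  by (auto intro!: derivative_eq_intros simp: algebra_simps power2_eq_square)

text \<open>If \<open>W\<close> is the Wronskian of \<open>x\<close> and \<open>cos (\<omega> t)\<close>, then \<open>W 0 = 0\<close> and
  \<open>W' = cos (\<omega> t) (x'' + \<omega>\<^sup>2 x) \<ge> - C\<close>, so \<open>W \<ge> - C\<close>. As \<open>(x / cos (\<omega> t))' = W / (cos (\<omega> t))\<^sup>2\<close>,
  the quotient decreases at a rate of at most \<open>C / (cos \<omega>)\<^sup>2\<close>.\<close>

lemma sturm_lower_bound:
  assumes C2: "C2_with_derivs x x' x''" and x'0: "x' 0 = 0"
    and \<omega>: "0 \<le> \<omega>" "\<omega> < pi / 2" and "0 \<le> C" and T: "T \<in> {0..1}"
    and ineq: "\<And>t. t \<in> {0..T} \<Longrightarrow> - C \<le> x'' t + \<omega>\<^sup>2 * x t"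
  shows "x 0 - C / (cos \<omega>)\<^sup>2 \<le> x T / cos (\<omega> * T)"
proof -
  define W where "W t = x' t * cos (\<omega> * t) + \<omega> * x t * sin (\<omega> * t)" for t
  define K where "K = C / (cos \<omega>)\<^sup>2"
  have cos_ge: "cos \<omega> \<le> cos (\<omega> * t)" if "t \<in> {0..1}" for t
    using that \<omega> by (intro cos_monotone_0_pi_le) (auto simp: mult_left_le)
  have cos_pos: "0 < cos \<omega>"
    using \<omega> by (intro cos_gt_zero_pi) auto
  have dW: "(W has_real_derivative cos (\<omega> * t) * (x'' t + \<omega>\<^sup>2 * x t)) (at t within {0..1})"
    if "t \<in> {0..1}" for t
    unfolding W_def by (rule wronskian_cos_derivative[OF C2 that])
  have W_ge: "- C \<le> W t" if t: "t \<in> {0..T}" for t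
  proof -
    have "W 0 + C * 0 \<le> W t + C * t"
    proof (rule nondecreasing_on_Icc[of 0 t "\<lambda>t. W t + C * t"])
      fix s assume s: "s \<in> {0..t}"
      show "((\<lambda>t. W t + C * t) has_real_derivative cos (\<omega> * s) * (x'' s + \<omega>\<^sup>2 * x s) + C)
          (at s within {0..t})"
        using s t T by (auto intro!: derivative_eq_intros DERIV_subset[OF dW])
      have "- C \<le> x'' s + \<omega>\<^sup>2 * x s" "0 < cos (\<omega> * s)" "cos (\<omega> * s) \<le> 1"
        using ineq[of s] s t T cos_ge[of s] cos_pos by auto
      then have "cos (\<omega> * s) * (- C) \<le> cos (\<omega> * s) * (x'' s + \<omega>\<^sup>2 * x s)"
        "cos (\<omega> * s) * C \<le> 1 * C"
        using \<open>0 \<le> C\<close> by (intro mult_left_mono mult_right_mono; simp)+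
      then show "0 \<le> cos (\<omega> * s) * (x'' s + \<omega>\<^sup>2 * x s) + C"
        by simp
    qed (use t in auto)
    moreover have "C * t \<le> C * 1"
      using t T \<open>0 \<le> C\<close> by (intro mult_left_mono) auto
    moreover have "W 0 = 0" by (simp add: W_def x'0)
    ultimately show ?thesis by simp
  qed
  have "x 0 / cos (\<omega> * 0) + K * 0 \<le> x T / cos (\<omega> * T) + K * T"
  proof (rule nondecreasing_on_Icc[of 0 T "\<lambda>t. x t / cos (\<omega> * t) + K * t"])
    fix t assume t: "t \<in> {0..T}"
    have c: "cos \<omega> \<le> cos (\<omega> * t)" "0 < cos (\<omega> * t)"
      using t T cos_ge[of t] cos_pos by auto
    have t1: "t \<in> {0..1}" using t T by auto
    have "((\<lambda>t. x t / cos (\<omega> * t)) has_real_derivative W t / (cos (\<omega> * t))\<^sup>2) (at t within {0..T})"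
      unfolding W_def using T c by (intro DERIV_subset[OF quotient_cos_derivative[OF C2 t1]]) auto
    then show "((\<lambda>t. x t / cos (\<omega> * t) + K * t) has_real_derivative W t / (cos (\<omega> * t))\<^sup>2 + K)
        (at t within {0..T})"
      by (intro DERIV_add DERIV_cmult_Id)
    have "C / (cos (\<omega> * t))\<^sup>2 \<le> K"
      unfolding K_def using c cos_pos \<open>0 \<le> C\<close> by (intro divide_left_mono power_mono) auto
    moreover have "- C / (cos (\<omega> * t))\<^sup>2 \<le> W t / (cos (\<omega> * t))\<^sup>2"
      using W_ge[OF t] by (intro divide_right_mono) auto
    ultimately show "0 \<le> W t / (cos (\<omega> * t))\<^sup>2 + K" by simp
  qed (use T in auto)
  moreover have "K * T \<le> K * 1"
    unfolding K_def using T \<open>0 \<le> C\<close> by (intro mult_left_mono) auto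
  ultimately show ?thesis by (simp add: K_def)
qed

text \<open>Here \<open>T = pi / (2 \<omega>)\<close> is the first zero of \<open>cos (\<omega> t)\<close>, and it lies in the interval. Up to
  \<open>T\<close> the Wronskian decreases from \<open>W 0 = 0\<close>, and \<open>W T = \<omega> x T\<close>.\<close>

lemma sturm_zero:
  assumes C2: "C2_with_derivs x x' x''" and x'0: "x' 0 = 0" and \<omega>: "pi / 2 \<le> \<omega>"
    and ineq: "\<And>t. t \<in> {0..1} \<Longrightarrow> x'' t + \<omega>\<^sup>2 * x t \<le> 0"
  shows "x (pi / (2 * \<omega>)) \<le> 0"
proof -
  define W where "W t = x' t * cos (\<omega> * t) + \<omega> * x t * sin (\<omega> * t)" for t
  define T where "T = pi / (2 * \<omega>)"
  have \<omega>0: "0 < \<omega>" using \<omega> pi_gt_zero by linarith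
  have \<omega>T: "\<omega> * T = pi / 2" using \<omega>0 by (simp add: T_def)
  have T: "0 < T" "T \<le> 1" using \<omega> \<omega>0 by (auto simp: T_def field_simps)
  have "- W 0 \<le> - W T"
  proof (rule nondecreasing_on_Icc[of 0 T "\<lambda>t. - W t"])
    fix t assume t: "t \<in> {0..T}"
    then have "t \<in> {0..1}" using T by auto
    then have "(W has_real_derivative cos (\<omega> * t) * (x'' t + \<omega>\<^sup>2 * x t)) (at t within {0..T})"
      unfolding W_def using T by (intro DERIV_subset[OF wronskian_cos_derivative[OF C2]]) auto
    then show "((\<lambda>t. - W t) has_real_derivative - (cos (\<omega> * t) * (x'' t + \<omega>\<^sup>2 * x t)))
        (at t within {0..T})"
      by (rule DERIV_minus)
    have "\<omega> * t \<le> \<omega> * T" using t \<omega>0 by (intro mult_left_mono) auto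
    then have "0 \<le> cos (\<omega> * t)" using \<omega>T t \<omega>0 by (intro cos_ge_zero) (auto intro: order_trans[of _ 0])
    then show "0 \<le> - (cos (\<omega> * t) * (x'' t + \<omega>\<^sup>2 * x t))"
      using ineq[OF \<open>t \<in> {0..1}\<close>] by (simp add: mult_nonneg_nonpos)
  qed (use T in auto)
  moreover have "W 0 = 0" by (simp add: W_def x'0)
  moreover have "W T = \<omega> * x T" by (simp add: W_def \<omega>T)
  ultimately show ?thesis using \<omega>0 by (simp add: T_def mult_le_0_iff)
qed

text \<open>Applying the lower bound with \<open>C = 0\<close> to both \<open>x\<close> and \<open>- x\<close> shows that \<open>x / cos (\<omega> t)\<close> is
  constant, and it vanishes at \<open>t = 1\<close>.\<close>

lemma homogeneous_bvp_unique:
  assumes C2: "C2_with_derivs x x' x''" and "x' 0 = 0" "x 1 = 0"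
    and \<omega>: "0 \<le> \<omega>" "\<omega> < pi / 2"
    and eq: "\<And>t. t \<in> {0..1} \<Longrightarrow> x'' t + \<omega>\<^sup>2 * x t = 0" and t: "t \<in> {0..1}"
  shows "x t = 0"
proof -
  have lower: "x 0 \<le> x T / cos (\<omega> * T)" if "T \<in> {0..1}" for T
    using sturm_lower_bound[OF C2 _ \<omega>, of 0 T] assms that by force
  have upper: "- x 0 \<le> - x T / cos (\<omega> * T)" if "T \<in> {0..1}" for T
    using sturm_lower_bound[OF C2_minus[OF C2] _ \<omega>, of 0 T] assms that by force
  have "x 0 = 0"
    using lower[of 1] upper[of 1] \<open>x 1 = 0\<close> by simp
  moreover have "0 < cos (\<omega> * t)"
    using t \<omega> mult_left_le[of t \<omega>] by (intro cos_gt_zero_pi) (auto intro: less_le_trans[of _ 0])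
  ultimately show ?thesis
    using lower[OF t] upper[OF t] by (simp add: zero_le_divide_iff divide_le_0_iff)
qed

section \<open>The first characteristic value\<close>

text \<open>The kernel is \<open>1 - max t s\<close>; in this form \<open>L\<close> becomes a constant minus the twofold integral.\<close>

lemma G_eq: "s \<in> {0..1} \<Longrightarrow> t \<in> {0..1} \<Longrightarrow> G t s = (1 - s) - max 0 (t - s)"
  by (auto simp: G_def)

text \<open>Together with \<open>L u 1 = 0\<close> this says that \<open>L u\<close> solves \<open>- v'' = u\<close>, \<open>v' 0 = 0 = v 1\<close>.\<close>

lemma L_C2:
  assumes u: "continuous_on {0..1} u"
  shows "C2_with_derivs (L u) (\<lambda>t. - integral {0..t} u) (\<lambda>t. - u t)"
proof (rule volterra_C2[OF u])
  fix t :: real assume t: "t \<in> {0..1}"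
  have "L u t = integral {0..1} (\<lambda>s. (1 - s) * u s - max 0 (t - s) *\<^sub>R u s)"
    unfolding L_def using t by (intro integral_cong) (auto simp: G_eq algebra_simps)
  also have "\<dots> = integral {0..1} (\<lambda>s. (1 - s) * u s) - volterra u t"
    unfolding volterra_def
    by (intro integral_diff integrable_continuous_real continuous_intros u)
  finally show "L u t = integral {0..1} (\<lambda>s. (1 - s) * u s) - volterra u t" .
qed

lemma L_at_1: "L u 1 = 0"
proof -
  have "L u 1 = integral {0..1} (\<lambda>s::real. 0)"
    unfolding L_def by (intro integral_cong) (auto simp: G_def)
  then show ?thesis by simp
qed

text \<open>The function \<open>cos (pi t / 2)\<close> is an eigenfunction, because \<open>L u\<close> and \<open>(4 / pi\<^sup>2) u\<close> solve the
  same boundary value problem. A positive characteristic value below \<open>pi\<^sup>2 / 4\<close> is impossible: its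
  eigenfunction \<open>u\<close> would make \<open>L u\<close> a solution of \<open>v'' + \<mu> v = 0\<close> with \<open>sqrt \<mu> < pi / 2\<close>, hence zero.\<close>

lemma \<mu>\<^sub>1_eq: "\<mu>\<^sub>1 = pi\<^sup>2 / 4"
  unfolding \<mu>\<^sub>1_def
proof (rule Least_equality)
  define u where "u t = cos (pi / 2 * t)" for t :: real
  have u: "continuous_on {0..1} u"
    unfolding u_def by (intro continuous_intros)
  have "C2_with_derivs (\<lambda>t. 4 / pi\<^sup>2 * u t) (\<lambda>t. - (2 / pi * sin (pi / 2 * t))) (\<lambda>t. - u t)"
    unfolding C2_with_derivs_def u_def
    by (auto intro!: derivative_eq_intros continuous_intros simp: power2_eq_square)
  then have C2: "C2_with_derivs (\<lambda>t. L u t - 4 / pi\<^sup>2 * u t)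
      (\<lambda>t. - integral {0..t} u - - (2 / pi * sin (pi / 2 * t))) (\<lambda>t. - u t - - u t)"
    by (intro C2_diff L_C2 u)
  have "L u t - 4 / pi\<^sup>2 * u t = 0" if "t \<in> {0..1}" for t
    by (rule homogeneous_bvp_unique[OF C2 _ _ _ _ _ that, of 0]) (auto simp: L_at_1 u_def)
  then have "\<forall>t\<in>{0..1}. 1 / (pi\<^sup>2 / 4) * u t = L u t"
    by auto
  moreover have "u 0 \<noteq> 0" by (simp add: u_def)
  ultimately show "0 < pi\<^sup>2 / 4 \<and> L_characteristic_value (pi\<^sup>2 / 4)"
    unfolding L_characteristic_value_def L_eigenvalue_def using u by force
next
  fix \<mu> assume \<mu>: "0 < \<mu> \<and> L_characteristic_value \<mu>"
  then obtain u where u: "continuous_on {0..1} u" "\<exists>t\<in>{0..1}. u t \<noteq> 0"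
    and eq: "\<And>t. t \<in> {0..1} \<Longrightarrow> 1 / \<mu> * u t = L u t"
    unfolding L_characteristic_value_def L_eigenvalue_def by blast
  have u_eq: "u t = \<mu> * L u t" if "t \<in> {0..1}" for t
    using eq[OF that] \<mu> by (auto simp: field_simps)
  show "pi\<^sup>2 / 4 \<le> \<mu>"
  proof (rule ccontr)
    assume "\<not> ?thesis"
    then have "sqrt \<mu> < sqrt ((pi / 2)\<^sup>2)"
      by (auto simp: power_divide)
    then have small: "sqrt \<mu> < pi / 2" by simp
    have "L u t = 0" if "t \<in> {0..1}" for t
      by (rule homogeneous_bvp_unique[OF L_C2[OF u(1)] _ L_at_1 _ small _ that])
         (use \<mu> u_eq in auto)
    then show False using u u_eq by auto
  qed
qed

section \<open>Consequences of the growth conditions\<close>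

text \<open>The next two lemmas turn the strict comparison of a limit with \<open>m\<close>, be the limit finite or
  not, into a uniform eventual bound by some number strictly on the same side of \<open>m\<close>.\<close>

lemma uniform_ereal_limit_ge:
  assumes lim: "uniform_ereal_limit S q l F" and l: "ereal m < l" and "0 \<le> m"
  shows "\<exists>b>m. \<forall>\<^sub>F x in F. \<forall>p\<in>S. b \<le> q x p"
proof (cases l)
  case (real r)
  then have "uniform_limit S q (\<lambda>_. r) F" "m < r"
    using lim l by (auto simp: uniform_ereal_limit_def)
  then have "\<forall>\<^sub>F x in F. \<forall>p\<in>S. dist (q x p) r < (r - m) / 2"
    by (auto dest: uniform_limitD[where e="(r - m) / 2"])
  then have "\<forall>\<^sub>F x in F. \<forall>p\<in>S. (m + r) / 2 \<le> q x p"
    by eventually_elim (fastforce simp: dist_real_def field_simps abs_if split: if_splits)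
  with \<open>m < r\<close> show ?thesis by (intro exI[of _ "(m + r) / 2"]) auto
next
  case PInf
  then have "\<forall>\<^sub>F x in F. \<forall>p\<in>S. m + 1 \<le> q x p"
    using lim \<open>0 \<le> m\<close> by (auto simp: uniform_ereal_limit_def)
  then show ?thesis by (intro exI[of _ "m + 1"]) auto
qed (use l in auto)

lemma uniform_ereal_limit_le:
  assumes lim: "uniform_ereal_limit S q l F" and l: "0 \<le> l" "l < ereal m"
  shows "\<exists>a. 0 < a \<and> a < m \<and> (\<forall>\<^sub>F x in F. \<forall>p\<in>S. q x p \<le> a)"
proof (cases l)
  case (real r)
  then have r: "uniform_limit S q (\<lambda>_. r) F" "r < m" "0 \<le> r"
    using lim l by (auto simp: uniform_ereal_limit_def)
  then have "\<forall>\<^sub>F x in F. \<forall>p\<in>S. dist (q x p) r < (m - r) / 2"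
    by (auto dest: uniform_limitD[where e="(m - r) / 2"])
  then have "\<forall>\<^sub>F x in F. \<forall>p\<in>S. q x p \<le> (m + r) / 2"
    by eventually_elim (fastforce simp: dist_real_def field_simps abs_if split: if_splits)
  with r show ?thesis by (intro exI[of _ "(m + r) / 2"]) auto
qed (use l in auto)

text \<open>The growth information that the shooting argument uses: a linear lower bound of slope above
  \<open>m\<close> near zero, and an affine upper bound of slope below \<open>m\<close> everywhere. For the latter, the
  constant \<open>C\<close> covers the bounded range on which the limit at infinity says nothing.\<close>

lemma linear_growth_bounds:
  fixes g :: "real \<Rightarrow> 'p \<Rightarrow> real"
  assumes lim_0: "uniform_ereal_limit S (\<lambda>u p. g u p / u) l0 (at_right 0)" "ereal m < l0"
    and lim_inf: "uniform_ereal_limit S (\<lambda>u p. g u p / u) linf at_top" "0 \<le> linf" "linf < ereal m"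
    and nonneg: "\<And>u p. 0 \<le> u \<Longrightarrow> p \<in> S \<Longrightarrow> 0 \<le> g u p"
    and bounded: "\<And>M. 0 < M \<Longrightarrow> \<exists>C>0. \<forall>u\<in>{0..M}. \<forall>p\<in>S. g u p \<le> C"
  obtains a b C d where "0 < a" "a < m" "m < b" "0 \<le> C" "0 < d"
    and "\<And>u p. p \<in> S \<Longrightarrow> 0 \<le> u \<Longrightarrow> u \<le> d \<Longrightarrow> b * u \<le> g u p"
    and "\<And>u p. p \<in> S \<Longrightarrow> 0 \<le> u \<Longrightarrow> g u p \<le> a * u + C"
proof -
  obtain a where a: "0 < a" "a < m" and ev_a: "\<forall>\<^sub>F u in at_top. \<forall>p\<in>S. g u p / u \<le> a"
    using uniform_ereal_limit_le[OF lim_inf] by blast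
  obtain b where b: "m < b" and ev_b: "\<forall>\<^sub>F u in at_right 0. \<forall>p\<in>S. b \<le> g u p / u"
    using uniform_ereal_limit_ge[OF lim_0] a by auto
  from ev_b obtain e where e: "0 < e" "\<And>u p. 0 < u \<Longrightarrow> u < e \<Longrightarrow> p \<in> S \<Longrightarrow> b \<le> g u p / u"
    unfolding eventually_at_right_field by auto
  from ev_a obtain N where N: "\<And>u p. N \<le> u \<Longrightarrow> p \<in> S \<Longrightarrow> g u p / u \<le> a"
    unfolding eventually_at_top_linorder by auto
  obtain C where C: "0 < C" "\<And>u p. 0 \<le> u \<Longrightarrow> u \<le> max 1 N \<Longrightarrow> p \<in> S \<Longrightarrow> g u p \<le> C"
    using bounded[of "max 1 N"] by (metis atLeastAtMost_iff less_max_iff_disj zero_less_one)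
  show thesis
  proof
    fix u :: real and p assume p: "p \<in> S" and u: "0 \<le> u"
    show "b * u \<le> g u p" if "u \<le> e / 2"
    proof (cases "u = 0")
      case False
      then show ?thesis using e(2)[of u p] p u that \<open>0 < e\<close> by (simp add: field_simps)
    qed (use nonneg p in simp)
    show "g u p \<le> a * u + C"
    proof (cases "u \<le> max 1 N")
      case True
      then show ?thesis using C(2)[OF u True p] a u by (simp add: add_increasing)
    next
      case False
      then have "g u p \<le> a * u" using N[of u p] p by (auto simp: field_simps)
      then show ?thesis using C(1) by simp
    qed
  qed (use a b C e in auto)
qed

section \<open>The delayed equation\<close>

text \<open>The \<open>k\<close>-th iterate has reached the solution of the delayed equation on \<open>t \<le> k h\<close>; beyond
  that point it is merely some continuous function. Before time \<open>0\<close> the state is frozen at its initial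
  value.\<close>

fun delay_iterate :: "(real \<Rightarrow> 'a::euclidean_space \<Rightarrow> 'a) \<Rightarrow> real \<Rightarrow> nat \<Rightarrow> 'a \<Rightarrow> real \<Rightarrow> 'a" where
  "delay_iterate F h 0 p t = p"
| "delay_iterate F h (Suc k) p t =
     p - volterra (\<lambda>s. F s (delay_iterate F h k p (max 0 (s - h)))) t"

text \<open>By causality the values up to \<open>(k + 1) h\<close> involve the previous iterate at times up to \<open>k h\<close>
  only, where it has already stabilised.\<close>

lemma delay_iterate_stable:
  assumes "0 \<le> h"
  shows "t \<le> real k * h \<Longrightarrow> delay_iterate F h (Suc k) p t = delay_iterate F h k p t"
proof (induction k arbitrary: t)
  case 0
  then show ?case by (simp add: volterra_0)
next
  case (Suc k)
  have "delay_iterate F h (Suc k) p (max 0 (s - h)) = delay_iterate F h k p (max 0 (s - h))"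
    if "s < t" for s
    using Suc.prems that assms by (intro Suc.IH) (auto simp: algebra_simps)
  then show ?case
    unfolding delay_iterate.simps(2)[of F h "Suc k"] delay_iterate.simps(2)[of F h k p t]
    by (intro arg_cong[of _ _ "(-) p"] volterra_cong) auto
qed

lemma continuous_on_delay_iterate:
  assumes F: "continuous_on ({0..1} \<times> UNIV) (\<lambda>(s, z). F s z)"
  shows "continuous_on UNIV (\<lambda>(p, t). delay_iterate F h k p t)"
proof (induction k)
  case 0
  show ?case by (auto simp: case_prod_beta intro!: continuous_intros)
next
  case (Suc k)
  have inner: "continuous_on (UNIV \<times> {0..1})
      (\<lambda>q. delay_iterate F h k (fst (fst q)) (max 0 (snd q - h)))"
    by (rule continuous_on_compose2[OF Suc, of _ "\<lambda>q. (fst (fst q), max 0 (snd q - h))", simplified])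
       (auto intro!: continuous_intros)
  have "continuous_on (UNIV \<times> {0..1})
      (\<lambda>q. F (snd q) (delay_iterate F h k (fst (fst q)) (max 0 (snd q - h))))"
    by (rule continuous_on_compose2[OF F, of _
          "\<lambda>q. (snd q, delay_iterate F h k (fst (fst q)) (max 0 (snd q - h)))", simplified])
       (auto intro!: continuous_intros inner)
  then have "continuous_on (UNIV \<times> cbox 0 1) (\<lambda>(q, s). max 0 (snd q - s) *\<^sub>R
      F s (delay_iterate F h k (fst q) (max 0 (s - h))))"
    by (auto simp: case_prod_beta intro!: continuous_intros)
  from integral_continuous_on_param[OF this] show ?case
    by (auto simp: case_prod_beta volterra_def intro!: continuous_intros)
qed

lemma delayed_solution_exists:
  fixes F :: "real \<Rightarrow> 'a::euclidean_space \<Rightarrow> 'a"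
  assumes F: "continuous_on ({0..1} \<times> UNIV) (\<lambda>(s, z). F s z)" and "0 < h"
  obtains Z where "continuous_on UNIV (\<lambda>(p, t). Z p t)"
    and "\<And>p t. t \<in> {0..1} \<Longrightarrow> Z p t = p - volterra (\<lambda>s. F s (Z p (max 0 (s - h)))) t"
proof -
  obtain k :: nat where k: "1 < real k * h"
    using reals_Archimedean3[OF \<open>0 < h\<close>] by blast
  show thesis
  proof
    show "continuous_on UNIV (\<lambda>(p, t). delay_iterate F h k p t)"
      by (rule continuous_on_delay_iterate[OF F])
    fix p :: 'a and t :: real assume "t \<in> {0..1}"
    then show "delay_iterate F h k p t =
        p - volterra (\<lambda>s. F s (delay_iterate F h k p (max 0 (s - h)))) t"
      using delay_iterate_stable[of h t k F p] k \<open>0 < h\<close> by simp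
  qed
qed

section \<open>Shooting in the plane\<close>

text \<open>Move \<open>(u, v)\<close> by \<open>- (P, Q)\<close> and clamp the result to the rectangle. At a fixed point of this
  map, \<open>P > 0\<close> would push \<open>u\<close> to the left, which the clamping can undo only at the left edge, where
  \<open>P \<le> 0\<close>; the other cases are symmetric.\<close>

lemma poincare_miranda_2:
  fixes P Q :: "real \<times> real \<Rightarrow> real"
  assumes P: "continuous_on ({a1..b1} \<times> {a2..b2}) P"
    and Q: "continuous_on ({a1..b1} \<times> {a2..b2}) Q"
    and le: "a1 \<le> b1" "a2 \<le> b2"
    and P_signs: "\<And>v. v \<in> {a2..b2} \<Longrightarrow> P (a1, v) \<le> 0" "\<And>v. v \<in> {a2..b2} \<Longrightarrow> 0 \<le> P (b1, v)"
    and Q_signs: "\<And>u. u \<in> {a1..b1} \<Longrightarrow> Q (u, a2) \<le> 0" "\<And>u. u \<in> {a1..b1} \<Longrightarrow> 0 \<le> Q (u, b2)"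
  obtains p where "p \<in> {a1..b1} \<times> {a2..b2}" "P p = 0" "Q p = 0"
proof -
  define f where "f p = (max a1 (min b1 (fst p - P p)), max a2 (min b2 (snd p - Q p)))" for p
  let ?S = "{a1..b1} \<times> {a2..b2}"
  obtain p where p: "p \<in> ?S" "f p = p"
  proof (rule brouwer[of ?S f])
    show "continuous_on ?S f"
      unfolding f_def by (intro continuous_intros P Q)
    show "f \<in> ?S \<rightarrow> ?S" using le by (auto simp: f_def)
  qed (use le in \<open>auto intro: compact_Times convex_Times\<close>)
  obtain u v where uv: "p = (u, v)" by (cases p)
  have fixp: "max a1 (min b1 (u - P (u, v))) = u" "max a2 (min b2 (v - Q (u, v))) = v"
    using p(2) by (auto simp: f_def uv)
  have box: "u \<in> {a1..b1}" "v \<in> {a2..b2}" using p(1) by (auto simp: uv)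
  have "P (u, v) = 0"
    using fixp(1) box P_signs[of v] by (smt (verit) atLeastAtMost_iff)
  moreover have "Q (u, v) = 0"
    using fixp(2) box Q_signs[of u] by (smt (verit) atLeastAtMost_iff)
  ultimately show thesis using p(1) that uv by blast
qed

text \<open>Suppose \<open>x 1 > 0\<close>. As \<open>x\<close> decreases, \<open>x s \<le> x (max 0 (s - h)) \<le> d\<close> throughout, so the delay
  only helps: \<open>- x'' \<ge> b x (max 0 (s - h)) \<ge> b x\<close>. Then \<open>x\<close> has become nonpositive when
  \<open>cos (sqrt b t)\<close> vanishes, which happens before \<open>t = 1\<close>.\<close>

lemma shot_from_low_height:
  assumes F: "continuous_on {0..1} F" "\<And>s. s \<in> {0..1} \<Longrightarrow> 0 \<le> F s"
    and x: "\<And>t. t \<in> {0..1} \<Longrightarrow> x t = d - volterra F t"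
    and "0 \<le> h" and b: "\<mu>\<^sub>1 < b"
    and low: "\<And>s. s \<in> {0..1} \<Longrightarrow> 0 \<le> x (max 0 (s - h)) \<Longrightarrow> x (max 0 (s - h)) \<le> d \<Longrightarrow>
      b * x (max 0 (s - h)) \<le> F s"
  shows "x 1 \<le> 0"
proof (rule ccontr)
  assume "\<not> x 1 \<le> 0"
  have anti: "x t \<le> x r" if "0 \<le> r" "r \<le> t" "t \<le> 1" for r t
    using volterra_mono[OF F \<open>r \<le> t\<close>] x[of r] x[of t] that by auto
  have x0: "x 0 = d" using x[of 0] by (simp add: volterra_0)
  define \<omega> where "\<omega> = sqrt b"
  have "pi / 2 = sqrt ((pi / 2)\<^sup>2)" by simp
  also have "\<dots> \<le> \<omega>"
    unfolding \<omega>_def using b by (intro real_sqrt_le_mono) (auto simp: \<mu>\<^sub>1_eq power_divide)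
  finally have \<omega>: "pi / 2 \<le> \<omega>" .
  then have "0 < \<omega>" using pi_gt_zero by linarith
  have b0: "0 < b" using \<open>0 < \<omega>\<close> by (simp add: \<omega>_def)
  have "x (pi / (2 * \<omega>)) \<le> 0"
  proof (rule sturm_zero[OF volterra_C2[OF F(1) x] _ \<omega>])
    fix t :: real assume t: "t \<in> {0..1}"
    have "0 < x t" using anti[of t 1] t \<open>\<not> x 1 \<le> 0\<close> by auto
    have *: "x t \<le> x (max 0 (t - h))" "x (max 0 (t - h)) \<le> d"
      using t \<open>0 \<le> h\<close> x0 by (auto intro!: anti simp flip: x0)
    then have "b * x t \<le> b * x (max 0 (t - h))" using b0 by simp
    also have "\<dots> \<le> F t" using low[OF t] * \<open>0 < x t\<close> by auto
    finally show "- F t + \<omega>\<^sup>2 * x t \<le> 0" using b0 by (simp add: \<omega>_def)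
  qed auto
  moreover have "x 1 \<le> x (pi / (2 * \<omega>))"
    using \<omega> \<open>0 < \<omega>\<close> by (intro anti) (auto simp: field_simps)
  ultimately show False using \<open>\<not> x 1 \<le> 0\<close> by simp
qed

text \<open>Here the delay acts in the wrong direction. But \<open>\<bar>x''\<bar>\<close> and hence the Lipschitz constant of
  \<open>x\<close> are at most \<open>a c + C\<close>, so for small \<open>h\<close> the delay costs no more than \<open>1\<close> in
  \<open>- x'' \<le> a x + C + 1\<close>. This inequality is available up to a zero \<open>T\<close> of \<open>x\<close>, because \<open>x\<close> is
  decreasing and so nonnegative before; at \<open>T\<close> the lower bound contradicts the size of \<open>c\<close>.\<close>

lemma shot_from_large_height:
  assumes F: "continuous_on {0..1} F" "\<And>s. s \<in> {0..1} \<Longrightarrow> 0 \<le> F s"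
    and x: "\<And>t. t \<in> {0..1} \<Longrightarrow> x t = c - volterra F t"
    and "0 \<le> h" and a: "0 < a" "a < \<mu>\<^sub>1" and "0 \<le> C"
    and c: "(C + 1) / (cos (sqrt a))\<^sup>2 < c" and h: "h * (a * (a * c + C)) \<le> 1"
    and high: "\<And>s. s \<in> {0..1} \<Longrightarrow> F s \<le> a * max 0 (x (max 0 (s - h))) + C"
  shows "0 \<le> x 1"
proof (rule ccontr)
  assume "\<not> 0 \<le> x 1"
  have anti: "x t \<le> x r" if "0 \<le> r" "r \<le> t" "t \<le> 1" for r t
    using volterra_mono[OF F \<open>r \<le> t\<close>] x[of r] x[of t] that by auto
  have x0: "x 0 = c" using x[of 0] by (simp add: volterra_0)
  have "0 \<le> (C + 1) / (cos (sqrt a))\<^sup>2" using \<open>0 \<le> C\<close> by simp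
  then have "0 < c" using c by linarith
  have "sqrt a < sqrt ((pi / 2)\<^sup>2)"
    using a by (intro real_sqrt_less_mono) (auto simp: \<mu>\<^sub>1_eq power_divide)
  then have \<omega>: "0 \<le> sqrt a" "sqrt a < pi / 2" using a by auto
  define K where "K = a * c + C"
  have FK: "norm (F s) \<le> K" if s: "s \<in> {0..1}" for s
  proof -
    have "max 0 (x (max 0 (s - h))) \<le> c"
      using \<open>0 < c\<close> \<open>0 \<le> h\<close> s by (auto intro!: anti simp flip: x0)
    then have "a * max 0 (x (max 0 (s - h))) \<le> a * c" using a by simp
    then show ?thesis using high[OF s] F(2)[OF s] by (simp add: K_def)
  qed
  have C2: "C2_with_derivs x (\<lambda>t. - integral {0..t} F) (\<lambda>t. - F t)"
    by (rule volterra_C2[OF F(1) x])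
  then have "continuous_on {0..1} x"
    unfolding C2_with_derivs_def by (meson DERIV_continuous_on)
  then obtain T where T: "0 \<le> T" "T \<le> 1" "x T = 0"
    using IVT2'[of x 1 0 0] \<open>\<not> 0 \<le> x 1\<close> \<open>0 < c\<close> x0 by auto
  have "x 0 - (C + 1) / (cos (sqrt a))\<^sup>2 \<le> x T / cos (sqrt a * T)"
  proof (rule sturm_lower_bound[OF C2 _ \<omega>])
    fix t assume t: "t \<in> {0..T}"
    then have t1: "t \<in> {0..1}" using T by auto
    define r where "r = max 0 (t - h)"
    have r: "0 \<le> r" "r \<le> t" "t - r \<le> h" using t \<open>0 \<le> h\<close> by (auto simp: r_def)
    have "x r - x t \<le> norm (volterra F t - volterra F r)"
      using x[of r] x[of t] t1 r by auto
    also have "\<dots> \<le> K * \<bar>t - r\<bar>"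
      by (rule volterra_Lipschitz[OF F(1) FK])
    also have "\<dots> \<le> K * h"
      using r a \<open>0 < c\<close> \<open>0 \<le> C\<close> by (intro mult_left_mono) (auto simp: K_def)
    finally have "a * x r \<le> a * (x t + K * h)" using a by simp
    moreover have "0 \<le> x r" using anti[of r T] T t r by auto
    then have "F t \<le> a * x r + C" using high[OF t1] by (simp add: r_def max_def)
    moreover have "a * (K * h) \<le> 1" using h by (simp add: K_def mult_ac)
    ultimately show "- (C + 1) \<le> - F t + (sqrt a)\<^sup>2 * x t"
      using a by (simp add: algebra_simps)
  qed (use T \<open>0 \<le> C\<close> in auto)
  then show False using T c x0 by simp
qed

text \<open>The sign condition on an edge of the rectangle fixes the initial value of one component, whose
  shooting estimate holds whatever the other component does.\<close>

lemma delayed_bvp_solution: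
  fixes F :: "real \<Rightarrow> real \<times> real \<Rightarrow> real \<times> real"
  assumes F: "continuous_on ({0..1} \<times> UNIV) (\<lambda>(s, w). F s w)"
    and nonneg: "\<And>s w. s \<in> {0..1} \<Longrightarrow> 0 \<le> fst (F s w)" "\<And>s w. s \<in> {0..1} \<Longrightarrow> 0 \<le> snd (F s w)"
    and a: "0 < a1" "a1 < \<mu>\<^sub>1" "0 < a2" "a2 < \<mu>\<^sub>1" and b: "\<mu>\<^sub>1 < b1" "\<mu>\<^sub>1 < b2"
    and C: "0 \<le> C1" "0 \<le> C2" and dR: "d1 \<le> R1" "d2 \<le> R2"
    and low: "\<And>s w. s \<in> {0..1} \<Longrightarrow> 0 \<le> fst w \<Longrightarrow> fst w \<le> d1 \<Longrightarrow> b1 * fst w \<le> fst (F s w)"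
      "\<And>s w. s \<in> {0..1} \<Longrightarrow> 0 \<le> snd w \<Longrightarrow> snd w \<le> d2 \<Longrightarrow> b2 * snd w \<le> snd (F s w)"
    and high: "\<And>s w. s \<in> {0..1} \<Longrightarrow> fst (F s w) \<le> a1 * max 0 (fst w) + C1"
      "\<And>s w. s \<in> {0..1} \<Longrightarrow> snd (F s w) \<le> a2 * max 0 (snd w) + C2"
    and R: "(C1 + 1) / (cos (sqrt a1))\<^sup>2 < R1" "(C2 + 1) / (cos (sqrt a2))\<^sup>2 < R2"
    and h: "0 < h" "h * (a1 * (a1 * R1 + C1)) \<le> 1" "h * (a2 * (a2 * R2 + C2)) \<le> 1"
  obtains p z where "p \<in> {d1..R1} \<times> {d2..R2}" "continuous_on {0..1} z" "z 1 = 0"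
    and "\<And>t. t \<in> {0..1} \<Longrightarrow> z t = p - volterra (\<lambda>s. F s (z (max 0 (s - h)))) t"
    and "\<And>t. t \<in> {0..1} \<Longrightarrow> z t \<in> {0..R1} \<times> {0..R2}"
proof -
  obtain Z where Z_cont: "continuous_on UNIV (\<lambda>(p, t). Z p t)"
    and Z: "\<And>p t. t \<in> {0..1} \<Longrightarrow> Z p t = p - volterra (\<lambda>s. F s (Z p (max 0 (s - h)))) t"
    using delayed_solution_exists[OF F h(1)] by blast
  define g where "g p s = F s (Z p (max 0 (s - h)))" for p s
  have Zt_cont: "continuous_on UNIV (\<lambda>p. Z p t)" for t
    by (rule continuous_on_compose2[OF Z_cont, of _ "\<lambda>p. (p, t)", simplified])
       (auto intro!: continuous_intros)
  have Zp_cont: "continuous_on A (Z p)" for A p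
    by (rule continuous_on_compose2[OF Z_cont, of _ "\<lambda>t. (p, t)", simplified])
       (auto intro!: continuous_intros)
  have g_cont: "continuous_on {0..1} (g p)" for p
    unfolding g_def
    by (rule continuous_on_compose2[OF F, of _ "\<lambda>s. (s, Z p (max 0 (s - h)))", simplified])
       (auto intro!: continuous_intros continuous_on_compose2[OF Zp_cont[of UNIV]])
  have Z_fst: "fst (Z p t) = fst p - volterra (\<lambda>s. fst (g p s)) t" if "t \<in> {0..1}" for p t
    using that volterra_linear[OF bounded_linear_fst g_cont, of p t] by (simp add: Z[of t] g_def[abs_def])
  have Z_snd: "snd (Z p t) = snd p - volterra (\<lambda>s. snd (g p s)) t" if "t \<in> {0..1}" for p t
    using that volterra_linear[OF bounded_linear_snd g_cont, of p t] by (simp add: Z[of t] g_def[abs_def])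
  have g_fst: "continuous_on {0..1} (\<lambda>s. fst (g p s))" "\<And>s. s \<in> {0..1} \<Longrightarrow> 0 \<le> fst (g p s)" for p
    by (intro continuous_intros g_cont) (simp add: g_def nonneg)
  have g_snd: "continuous_on {0..1} (\<lambda>s. snd (g p s))" "\<And>s. s \<in> {0..1} \<Longrightarrow> 0 \<le> snd (g p s)" for p
    by (intro continuous_intros g_cont) (simp add: g_def nonneg)
  obtain p where p: "p \<in> {d1..R1} \<times> {d2..R2}" and zero: "fst (Z p 1) = 0" "snd (Z p 1) = 0"
  proof (rule poincare_miranda_2[of d1 R1 d2 R2 "\<lambda>p. fst (Z p 1)" "\<lambda>p. snd (Z p 1)"])
    show "continuous_on ({d1..R1} \<times> {d2..R2}) (\<lambda>p. fst (Z p 1))"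
      "continuous_on ({d1..R1} \<times> {d2..R2}) (\<lambda>p. snd (Z p 1))"
      by (auto intro!: continuous_intros continuous_on_subset[OF Zt_cont])
    show "fst (Z (d1, v) 1) \<le> 0" for v
      by (rule shot_from_low_height[OF g_fst Z_fst[of _ "(d1, v)"] less_imp_le[OF h(1)] b(1)])
         (use h low in \<open>auto simp: g_def\<close>)
    show "0 \<le> fst (Z (R1, v) 1)" for v
      by (rule shot_from_large_height[OF g_fst Z_fst[of _ "(R1, v)"] less_imp_le[OF h(1)] a(1,2) C(1)])
         (use h high R in \<open>auto simp: g_def\<close>)
    show "snd (Z (u, d2) 1) \<le> 0" for u
      by (rule shot_from_low_height[OF g_snd Z_snd[of _ "(u, d2)"] less_imp_le[OF h(1)] b(2)])
         (use h low in \<open>auto simp: g_def\<close>)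
    show "0 \<le> snd (Z (u, R2) 1)" for u
      by (rule shot_from_large_height[OF g_snd Z_snd[of _ "(u, R2)"] less_imp_le[OF h(1)] a(3,4) C(2)])
         (use h high R in \<open>auto simp: g_def\<close>)
  qed (use dR in auto)
  have "Z p t \<in> {0..R1} \<times> {0..R2}" if t: "t \<in> {0..1}" for t
  proof -
    have "volterra (\<lambda>s. fst (g p s)) 0 \<le> volterra (\<lambda>s. fst (g p s)) t"
      "volterra (\<lambda>s. fst (g p s)) t \<le> volterra (\<lambda>s. fst (g p s)) 1"
      "volterra (\<lambda>s. snd (g p s)) 0 \<le> volterra (\<lambda>s. snd (g p s)) t"
      "volterra (\<lambda>s. snd (g p s)) t \<le> volterra (\<lambda>s. snd (g p s)) 1"
      using t by (auto intro!: volterra_mono g_fst g_snd)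
    then show ?thesis
      using p zero Z_fst[of t p] Z_fst[of 1 p] Z_snd[of t p] Z_snd[of 1 p] t
      by (auto simp: volterra_0 mem_Times_iff)
  qed
  moreover have "Z p 1 = 0" using zero by (simp add: prod_eq_iff)
  ultimately show thesis using that p Zp_cont Z by blast
qed

section \<open>Removing the delay\<close>

text \<open>Bounded solutions have a common bound \<open>K\<close> for the right-hand sides, hence a common Lipschitz
  constant \<open>K\<close>, and a subsequence converges uniformly. Since a delay changes the argument by at most
  \<open>h\<close>, the delayed states converge to the same limit, and dominated convergence passes to the limit in
  the integral.\<close>

lemma delayed_solutions_limit:
  fixes F :: "real \<Rightarrow> 'a::euclidean_space \<Rightarrow> 'a" and z :: "nat \<Rightarrow> real \<Rightarrow> 'a"
  assumes F: "continuous_on ({0..1} \<times> UNIV) (\<lambda>(s, w). F s w)"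
    and h: "\<And>n. 0 \<le> h n" "h \<longlonglongrightarrow> 0"
    and z_cont: "\<And>n. continuous_on {0..1} (z n)"
    and z_eq: "\<And>n t. t \<in> {0..1} \<Longrightarrow> z n t = p n - volterra (\<lambda>s. F s (z n (max 0 (s - h n)))) t"
    and z_bound: "\<And>n t. t \<in> {0..1} \<Longrightarrow> norm (z n t) \<le> B"
  obtains w k where "continuous_on {0..1} w" "strict_mono (k :: nat \<Rightarrow> nat)"
    and "\<And>t. t \<in> {0..1} \<Longrightarrow> (\<lambda>n. z (k n) t) \<longlonglongrightarrow> w t"
    and "\<And>t. t \<in> {0..1} \<Longrightarrow> w t = w 0 - volterra (\<lambda>s. F s (w s)) t"
proof -
  define g where "g n s = F s (z n (max 0 (s - h n)))" for n s
  have arg: "max 0 (s - h n) \<in> {0..1}" if "s \<in> {0..1}" for n s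
    using that h(1)[of n] by auto
  have "compact ((\<lambda>(s, w). F s w) ` ({0..1} \<times> cball 0 B))"
    by (intro compact_continuous_image continuous_on_subset[OF F] compact_Times) auto
  then obtain K where "\<And>q. q \<in> (\<lambda>(s, w). F s w) ` ({0..1} \<times> cball 0 B) \<Longrightarrow> norm q \<le> K"
    using compact_imp_bounded bounded_iff by metis
  then have K: "norm (F s w) \<le> K" if "s \<in> {0..1}" "norm w \<le> B" for s w
    using that by force
  then have gK: "norm (g n s) \<le> K" if "s \<in> {0..1}" for n s
    using that arg z_bound by (simp add: g_def)
  have "0 \<le> K" using order_trans[OF norm_ge_zero gK[of 0 0]] by simp
  have g_cont: "continuous_on {0..1} (g n)" for n
  proof -
    have "continuous_on {0..1} (\<lambda>s. z n (max 0 (s - h n)))"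
      by (rule continuous_on_compose2[OF z_cont]) (use arg in \<open>auto intro!: continuous_intros\<close>)
    then show ?thesis
      unfolding g_def
      by (intro continuous_on_compose2[OF F, of _ "\<lambda>s. (s, z n (max 0 (s - h n)))", simplified])
         (auto intro!: continuous_intros)
  qed
  have Lip: "norm (z n t - z n r) \<le> K * \<bar>t - r\<bar>" if "t \<in> {0..1}" "r \<in> {0..1}" for n t r
    using volterra_Lipschitz[OF g_cont gK, of n t r] that
    by (simp add: z_eq g_def norm_minus_commute)
  have equi: "\<exists>d>0. \<forall>n y. y \<in> {0..1} \<and> norm (x - y) < d \<longrightarrow> norm (z n x - z n y) < e"
    if "x \<in> {0..1}" "0 < e" for x e :: real
  proof (intro exI[of _ "e / (K + 1)"] conjI allI impI)
    fix n y assume y: "y \<in> {0..1} \<and> norm (x - y) < e / (K + 1)"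
    have "norm (z n x - z n y) \<le> K * \<bar>x - y\<bar>" using Lip that y by auto
    also have "\<dots> \<le> (K + 1) * \<bar>x - y\<bar>" by (intro mult_right_mono) auto
    also have "\<dots> < e" using y \<open>0 \<le> K\<close> by (simp add: field_simps)
    finally show "norm (z n x - z n y) < e" .
  qed (use \<open>0 < e\<close> \<open>0 \<le> K\<close> in auto)
  obtain w k where w: "continuous_on {0..1} w" and k: "strict_mono (k :: nat \<Rightarrow> nat)"
    and unif: "\<And>e. 0 < e \<Longrightarrow> \<exists>N. \<forall>n x. n \<ge> N \<and> x \<in> {0..1} \<longrightarrow> norm (z (k n) x - w x) < e"
    by (rule Arzela_Ascoli[of "{0..1}" z B, OF compact_Icc z_bound equi]) auto
  have conv: "(\<lambda>n. z (k n) t) \<longlonglongrightarrow> w t" if "t \<in> {0..1}" for t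
    unfolding LIMSEQ_iff using unif that by meson
  have hk: "(\<lambda>n. h (k n)) \<longlonglongrightarrow> 0"
    using LIMSEQ_subseq_LIMSEQ[OF h(2) k] by (simp add: o_def)
  have g_conv: "(\<lambda>n. g (k n) s) \<longlonglongrightarrow> F s (w s)" if s: "s \<in> {0..1}" for s
  proof -
    have "(\<lambda>n. z (k n) (max 0 (s - h (k n))) - z (k n) s) \<longlonglongrightarrow> 0"
    proof (rule Lim_null_comparison)
      show "\<forall>\<^sub>F n in sequentially. norm (z (k n) (max 0 (s - h (k n))) - z (k n) s) \<le> K * h (k n)"
      proof (intro always_eventually allI)
        fix n
        have "norm (z (k n) (max 0 (s - h (k n))) - z (k n) s) \<le> K * \<bar>max 0 (s - h (k n)) - s\<bar>"
          by (rule Lip) (use s arg in auto)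
        also have "\<dots> \<le> K * h (k n)"
          using \<open>0 \<le> K\<close> s h(1)[of "k n"] by (intro mult_left_mono) auto
        finally show "norm (z (k n) (max 0 (s - h (k n))) - z (k n) s) \<le> K * h (k n)" .
      qed
      show "(\<lambda>n. K * h (k n)) \<longlonglongrightarrow> 0" using tendsto_mult_right_zero[OF hk] .
    qed
    from tendsto_add[OF this conv[OF s]]
    have "(\<lambda>n. z (k n) (max 0 (s - h (k n)))) \<longlonglongrightarrow> w s" by simp
    moreover have "continuous_on UNIV (F s)"
      by (rule continuous_on_compose2[OF F, of _ "\<lambda>w. (s, w)", simplified])
         (use s in \<open>auto intro!: continuous_intros\<close>)
    then have "isCont (F s) (w s)" by (simp add: continuous_on_eq_continuous_at)
    ultimately show ?thesis unfolding g_def by (rule isCont_tendsto_compose[rotated])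
  qed
  have "w t = w 0 - volterra (\<lambda>s. F s (w s)) t" if t: "t \<in> {0..1}" for t
  proof -
    have "(\<lambda>n. volterra (g (k n)) t) \<longlonglongrightarrow> volterra (\<lambda>s. F s (w s)) t"
      unfolding volterra_def
    proof (rule dominated_convergence(2)[where h="\<lambda>_. K"])
      fix n and s :: real assume s: "s \<in> {0..1}"
      have "norm (max 0 (t - s) *\<^sub>R g (k n) s) = max 0 (t - s) * norm (g (k n) s)" by simp
      also have "\<dots> \<le> 1 * K" using gK[OF s] t s by (intro mult_mono) auto
      finally show "norm (max 0 (t - s) *\<^sub>R g (k n) s) \<le> K" by simp
    qed (auto intro!: integrable_continuous_real continuous_intros g_cont tendsto_intros g_conv)
    moreover have "(\<lambda>n. volterra (g (k n)) t) = (\<lambda>n. z (k n) 0 - z (k n) t)"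
      using t by (simp add: z_eq[of 0] z_eq[of t] g_def[abs_def] volterra_0)
    moreover have "(\<lambda>n. z (k n) 0 - z (k n) t) \<longlonglongrightarrow> w 0 - w t"
      using t by (intro tendsto_intros conv) auto
    ultimately have "volterra (\<lambda>s. F s (w s)) t = w 0 - w t"
      using LIMSEQ_unique by auto
    then show ?thesis by simp
  qed
  with w k conv that show thesis by blast
qed

theorem theorem3p1:
  fixes f1 f2 :: "real \<Rightarrow> real \<Rightarrow> real \<Rightarrow> real"
    and f1_0 f2_0 f1_inf f2_inf :: ereal
  assumes cont1: "continuous_on ({0..1} \<times> {0..} \<times> {0..}) (\<lambda>(t, x1, x2). f1 t x1 x2)"
    and cont2: "continuous_on ({0..1} \<times> {0..} \<times> {0..}) (\<lambda>(t, x1, x2). f2 t x1 x2)"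
    and nonneg1: "\<forall>t\<in>{0..1}. \<forall>x1\<in>{0..}. \<forall>x2\<in>{0..}. 0 \<le> f1 t x1 x2"
    and nonneg2: "\<forall>t\<in>{0..1}. \<forall>x1\<in>{0..}. \<forall>x2\<in>{0..}. 0 \<le> f2 t x1 x2"
    and bound1: "\<forall>M>0. \<exists>C>0. \<forall>t\<in>{0..1}. \<forall>x1\<in>{0..M}. \<forall>x2\<in>{0..}. f1 t x1 x2 \<le> C"
    and bound2: "\<forall>M>0. \<exists>C>0. \<forall>t\<in>{0..1}. \<forall>x2\<in>{0..M}. \<forall>x1\<in>{0..}. f2 t x1 x2 \<le> C"
    and lim1_0: "uniform_ereal_limit ({0..1} \<times> {0..}) (\<lambda>x1 (t, x2). f1 t x1 x2 / x1) f1_0 (at_right 0)"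
    and lim2_0: "uniform_ereal_limit ({0..1} \<times> {0..}) (\<lambda>x2 (t, x1). f2 t x1 x2 / x2) f2_0 (at_right 0)"
    and lim1_inf: "uniform_ereal_limit ({0..1} \<times> {0..}) (\<lambda>x1 (t, x2). f1 t x1 x2 / x1) f1_inf at_top"
    and lim2_inf: "uniform_ereal_limit ({0..1} \<times> {0..}) (\<lambda>x2 (t, x1). f2 t x1 x2 / x2) f2_inf at_top"
    and zero1: "ereal \<mu>\<^sub>1 < f1_0" "f1_0 \<le> \<infinity>"
    and zero2: "ereal \<mu>\<^sub>1 < f2_0" "f2_0 \<le> \<infinity>"
    and inf1: "0 \<le> f1_inf" "f1_inf < ereal \<mu>\<^sub>1"
    and inf2: "0 \<le> f2_inf" "f2_inf < ereal \<mu>\<^sub>1"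
  shows "\<exists>x y. solves_system f1 f2 x y \<and>
    (\<forall>t\<in>{0..1}. 0 \<le> x t) \<and> (\<forall>t\<in>{0..1}. 0 \<le> y t) \<and>
    (\<exists>t\<in>{0..1}. x t \<noteq> 0) \<and> (\<exists>t\<in>{0..1}. y t \<noteq> 0)"
proof -
  have split1: "(\<lambda>x1 (t, x2). f1 t x1 x2 / x1) = (\<lambda>u p. (case p of (t, v) \<Rightarrow> f1 t u v) / u)"
    and split2: "(\<lambda>x2 (t, x1). f2 t x1 x2 / x2) = (\<lambda>u p. (case p of (t, v) \<Rightarrow> f2 t v u) / u)"
    by (auto simp: fun_eq_iff)
  obtain a1 b1 C1 d1 where a1: "0 < a1" "a1 < \<mu>\<^sub>1" and b1: "\<mu>\<^sub>1 < b1" and C1: "0 \<le> C1" and d1: "0 < d1"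
    and low1': "\<And>u p. p \<in> {0..1} \<times> {0..} \<Longrightarrow> 0 \<le> u \<Longrightarrow> u \<le> d1 \<Longrightarrow> b1 * u \<le> (case p of (t, v) \<Rightarrow> f1 t u v)"
    and high1': "\<And>u p. p \<in> {0..1} \<times> {0..} \<Longrightarrow> 0 \<le> u \<Longrightarrow> (case p of (t, v) \<Rightarrow> f1 t u v) \<le> a1 * u + C1"
  proof (rule linear_growth_bounds[OF lim1_0[unfolded split1] zero1(1) lim1_inf[unfolded split1] inf1])
    show "\<exists>C>0. \<forall>u\<in>{0..M}. \<forall>p\<in>{0..1} \<times> {0..}. (case p of (t, v) \<Rightarrow> f1 t u v) \<le> C" if "0 < M" for M
      using bound1[rule_format, OF that] by auto
  qed (use nonneg1 in auto)
  obtain a2 b2 C2 d2 where a2: "0 < a2" "a2 < \<mu>\<^sub>1" and b2: "\<mu>\<^sub>1 < b2" and C2: "0 \<le> C2" and d2: "0 < d2"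
    and low2': "\<And>u p. p \<in> {0..1} \<times> {0..} \<Longrightarrow> 0 \<le> u \<Longrightarrow> u \<le> d2 \<Longrightarrow> b2 * u \<le> (case p of (t, v) \<Rightarrow> f2 t v u)"
    and high2': "\<And>u p. p \<in> {0..1} \<times> {0..} \<Longrightarrow> 0 \<le> u \<Longrightarrow> (case p of (t, v) \<Rightarrow> f2 t v u) \<le> a2 * u + C2"
  proof (rule linear_growth_bounds[OF lim2_0[unfolded split2] zero2(1) lim2_inf[unfolded split2] inf2])
    show "\<exists>C>0. \<forall>u\<in>{0..M}. \<forall>p\<in>{0..1} \<times> {0..}. (case p of (t, v) \<Rightarrow> f2 t v u) \<le> C" if "0 < M" for M
      using bound2[rule_format, OF that] by auto
  qed (use nonneg2 in auto)
  have low1: "b1 * u \<le> f1 t u v" if "t \<in> {0..1}" "0 \<le> v" "0 \<le> u" "u \<le> d1" for t u v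
    using low1'[of "(t, v)" u] that by simp
  have high1: "f1 t u v \<le> a1 * u + C1" if "t \<in> {0..1}" "0 \<le> v" "0 \<le> u" for t u v
    using high1'[of "(t, v)" u] that by simp
  have low2: "b2 * v \<le> f2 t u v" if "t \<in> {0..1}" "0 \<le> u" "0 \<le> v" "v \<le> d2" for t u v
    using low2'[of "(t, u)" v] that by simp
  have high2: "f2 t u v \<le> a2 * v + C2" if "t \<in> {0..1}" "0 \<le> u" "0 \<le> v" for t u v
    using high2'[of "(t, u)" v] that by simp

  \<comment> \<open>Extending the nonlinearity constantly to negative arguments makes shots that cross zero
      meaningful.\<close>
  define F where "F s w = (f1 s (max 0 (fst w)) (max 0 (snd w)), f2 s (max 0 (fst w)) (max 0 (snd w)))"
    for s and w :: "real \<times> real"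
  have F: "continuous_on ({0..1} \<times> UNIV) (\<lambda>(s, w). F s w)"
  proof -
    let ?c = "\<lambda>q::real \<times> real \<times> real. (fst q, max 0 (fst (snd q)), max 0 (snd (snd q)))"
    have "continuous_on ({0..1} \<times> UNIV) (\<lambda>q. (case ?c q of (t, x1, x2) \<Rightarrow> f1 t x1 x2,
        case ?c q of (t, x1, x2) \<Rightarrow> f2 t x1 x2))"
      by (intro continuous_on_Pair continuous_on_compose2[OF cont1] continuous_on_compose2[OF cont2])
         (auto intro!: continuous_intros)
    then show ?thesis by (simp add: F_def case_prod_beta)
  qed
  define R1 where "R1 = (C1 + 1) / (cos (sqrt a1))\<^sup>2 + d1"
  define R2 where "R2 = (C2 + 1) / (cos (sqrt a2))\<^sup>2 + d2"
  have R: "(C1 + 1) / (cos (sqrt a1))\<^sup>2 < R1" "(C2 + 1) / (cos (sqrt a2))\<^sup>2 < R2" "d1 \<le> R1" "d2 \<le> R2"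
    using d1 d2 C1 C2 by (auto simp: R1_def R2_def)
  \<comment> \<open>The delays \<open>1 / (H (n + 1))\<close> are all small enough for the estimate from large heights.\<close>
  define H where "H = max 1 (max (a1 * (a1 * R1 + C1)) (a2 * (a2 * R2 + C2)))"
  define h where "h n = 1 / (H * real (Suc n))" for n
  have H: "1 \<le> H" "a1 * (a1 * R1 + C1) \<le> H" "a2 * (a2 * R2 + C2) \<le> H" by (auto simp: H_def)
  have h_pos: "0 < h n" for n using H(1) by (simp add: h_def)
  have h_small: "h n * c \<le> 1" if "c \<le> H" for n c
  proof -
    have "c \<le> H * 1" using that by simp
    also have "\<dots> \<le> H * real (Suc n)" using H(1) by (intro mult_left_mono) auto
    finally show ?thesis using H(1) by (simp add: h_def)
  qed
  have h_lim: "h \<longlonglongrightarrow> 0"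
  proof -
    have "(\<lambda>n. 1 / H * inverse (real (Suc n))) \<longlonglongrightarrow> 0"
      by (rule tendsto_mult_right_zero[OF LIMSEQ_inverse_real_of_nat])
    then show ?thesis by (simp add: h_def[abs_def] divide_simps)
  qed
  define sol where "sol n p z \<longleftrightarrow> p \<in> {d1..R1} \<times> {d2..R2} \<and> continuous_on {0..1} z \<and> z 1 = 0 \<and>
      (\<forall>t\<in>{0..1}. z t = p - volterra (\<lambda>s. F s (z (max 0 (s - h n)))) t) \<and>
      (\<forall>t\<in>{0..1}. z t \<in> {0..R1} \<times> {0..R2})" for n p z
  have "\<exists>p z. sol n p z" for n
  proof (rule delayed_bvp_solution[OF F _ _ a1 a2 b1 b2 C1 C2 R(3,4) _ _ _ _ R(1,2) h_pos[of n]
        h_small[OF H(2)] h_small[OF H(3)]])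
    fix s :: real and w :: "real \<times> real" assume s: "s \<in> {0..1}"
    show "0 \<le> fst (F s w)" "0 \<le> snd (F s w)"
      using nonneg1 nonneg2 s by (auto simp: F_def)
    show "b1 * fst w \<le> fst (F s w)" if "0 \<le> fst w" "fst w \<le> d1"
      using low1[OF s, of "max 0 (snd w)" "fst w"] that by (simp add: F_def)
    show "b2 * snd w \<le> snd (F s w)" if "0 \<le> snd w" "snd w \<le> d2"
      using low2[OF s, of "max 0 (fst w)" "snd w"] that by (simp add: F_def)
    show "fst (F s w) \<le> a1 * max 0 (fst w) + C1"
      using high1[OF s, of "max 0 (snd w)" "max 0 (fst w)"] by (simp add: F_def)
    show "snd (F s w) \<le> a2 * max 0 (snd w) + C2"
      using high2[OF s, of "max 0 (fst w)" "max 0 (snd w)"] by (simp add: F_def)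
  next
    fix p z
    assume "p \<in> {d1..R1} \<times> {d2..R2}" "continuous_on {0..1} z" "z 1 = 0"
      and "\<And>t. t \<in> {0..1} \<Longrightarrow> z t = p - volterra (\<lambda>s. F s (z (max 0 (s - h n)))) t"
      and "\<And>t. t \<in> {0..1} \<Longrightarrow> z t \<in> {0..R1} \<times> {0..R2}"
    then have "sol n p z" unfolding sol_def by (intro conjI ballI)
    then show ?thesis by blast
  qed
  then obtain p z where sol: "\<And>n. sol n (p n) (z n)" by metis
  have p: "p n \<in> {d1..R1} \<times> {d2..R2}" and z: "continuous_on {0..1} (z n)" "z n 1 = 0"
      "\<And>t. t \<in> {0..1} \<Longrightarrow> z n t = p n - volterra (\<lambda>s. F s (z n (max 0 (s - h n)))) t"
      "\<And>t. t \<in> {0..1} \<Longrightarrow> z n t \<in> {0..R1} \<times> {0..R2}" for n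
    using sol[of n] unfolding sol_def by blast+
  have z_bound: "norm (z n t) \<le> R1 + R2" if "t \<in> {0..1}" for n t
    using z(4)[OF that, of n] norm_Pair_le[of "fst (z n t)" "snd (z n t)"] by (auto simp: mem_Times_iff)
  obtain w k where w: "continuous_on {0..1} w" and "strict_mono (k :: nat \<Rightarrow> nat)"
    and conv: "\<And>t. t \<in> {0..1} \<Longrightarrow> (\<lambda>n. z (k n) t) \<longlonglongrightarrow> w t"
    and w_eq: "\<And>t. t \<in> {0..1} \<Longrightarrow> w t = w 0 - volterra (\<lambda>s. F s (w s)) t"
  proof (rule delayed_solutions_limit[OF F less_imp_le[OF h_pos] h_lim z(1) z(3) z_bound])
    fix w k
    assume "continuous_on {0..1} w" "strict_mono (k :: nat \<Rightarrow> nat)"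
      and "\<And>t. t \<in> {0..1} \<Longrightarrow> (\<lambda>n. z (k n) t) \<longlonglongrightarrow> w t"
      and "\<And>t. t \<in> {0..1} \<Longrightarrow> w t = w 0 - volterra (\<lambda>s. F s (w s)) t"
    then show thesis by (rule that)
  qed
  have w_range: "w t \<in> {0..R1} \<times> {0..R2}" if "t \<in> {0..1}" for t
    by (rule closed_sequentially[OF _ _ conv[OF that]]) (use z(4) that in \<open>auto intro: closed_Times\<close>)
  \<comment> \<open>The initial values stay away from zero in the limit; this is what makes both components
      non-trivial.\<close>
  have w_0: "w 0 \<in> {d1..R1} \<times> {d2..R2}"
    by (rule closed_sequentially[OF _ _ conv[of 0]])
       (use p in \<open>auto intro: closed_Times simp: z(3)[of 0] volterra_0\<close>)
  have w_1: "w 1 = 0"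
    using conv[of 1] by (simp add: z(2) LIMSEQ_const_iff)
  have Fw: "continuous_on {0..1} (\<lambda>s. F s (w s))"
    by (rule continuous_on_compose2[OF F, of _ "\<lambda>s. (s, w s)", simplified])
       (auto intro!: continuous_intros w)
  define x where "x t = fst (w t)" for t
  define y where "y t = snd (w t)" for t
  have F_eq: "fst (F s (w s)) = f1 s (x s) (y s)" "snd (F s (w s)) = f2 s (x s) (y s)"
    if "s \<in> {0..1}" for s
    using w_range[OF that] by (auto simp: F_def x_def y_def mem_Times_iff)
  have Cx: "C2_with_derivs x (\<lambda>t. - integral {0..t} (\<lambda>s. fst (F s (w s)))) (\<lambda>t. - fst (F t (w t)))"
  proof (rule volterra_C2)
    show "x t = x 0 - volterra (\<lambda>s. fst (F s (w s))) t" if "t \<in> {0..1}" for t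
      using w_eq[OF that] volterra_linear[OF bounded_linear_fst Fw, of t] unfolding x_def
      by (metis fst_diff)
  qed (intro continuous_intros Fw)
  have Cy: "C2_with_derivs y (\<lambda>t. - integral {0..t} (\<lambda>s. snd (F s (w s)))) (\<lambda>t. - snd (F t (w t)))"
  proof (rule volterra_C2)
    show "y t = y 0 - volterra (\<lambda>s. snd (F s (w s))) t" if "t \<in> {0..1}" for t
      using w_eq[OF that] volterra_linear[OF bounded_linear_snd Fw, of t] unfolding y_def
      by (metis snd_diff)
  qed (intro continuous_intros Fw)
  have "solves_system f1 f2 x y"
    unfolding solves_system_def
    by (intro exI conjI) (rule Cx, rule Cy, auto simp: F_eq, auto simp: x_def y_def w_1)
  moreover have "0 \<le> x t" "0 \<le> y t" if "t \<in> {0..1}" for t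
    using w_range[OF that] by (auto simp: x_def y_def mem_Times_iff)
  moreover have "x 0 \<noteq> 0" "y 0 \<noteq> 0"
    using w_0 d1 d2 by (auto simp: x_def y_def mem_Times_iff)
  ultimately show ?thesis by (intro exI[of _ x] exI[of _ y]) auto
qed

end
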